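(* (Meta-theorem: coarse MLSI implies asymptotic completeness of free-energy dissipation.) Suppose that the de Bruijn-type identity $$F(\mu S_t)=F(\mu S_0)-\int_0^t\sigma(\mu S_s)\,\mathrm ds$$ holds, and that a coarse modified log-Sobolev inequality (coarse MLSI) holds, i.e. for every $\epsilon>0$ there is some $\delta=\delta(\epsilon)>0$ such that for all (allowed) initial distributions $\mu$, $$\sigma(\mu)\ge\delta\,\big([F(\mu)-\min_\nu F(\nu)]-\epsilon\big).$$ Then $$F(\mu S_t)\xrightarrow[t\to\infty]{}\min_\nu F(\nu)$$ for all (allowed) initial distributions $\mu$.
   Context: This is a meta-theorem, formulated for a general setting. $(S_t)_{t\ge 0}$ is a Markov semigroup, and $\mu S_t$ denotes the distribution at time $t\ge 0$ of the evolution started from the initial probability distribution $\mu$. $F$ is a bounded-from-below Lyapunov functional on probability measures, called the free energy, and $\min_\nu F(\nu)$ is its minimum. $\sigma$ is a non-negative functional on probability measures, called the entropy production. The word "allowed" refers to the class of initial distributions under consideration in the concrete setting to which the meta-theorem is applied (for example, the translation-invariant probability measures in the case of Ising Glauber dynamics); the meta-theorem does not specify this class further.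
   Formalization: The class of allowed initial distributions is assumed to be closed under the evolution (if μ is allowed, so is μS_t for every t ≥ 0); without this the coarse MLSI says nothing at positive times and the claim can fail. *)

theory Defs
  imports "HOL-Probability.Probability"
begin

text \<open>
  \<open>S t x\<close> is the law at time \<open>t\<close> of the process started in \<open>x\<close>; only times \<open>t \<ge> 0\<close>
  and points \<open>x \<in> space M\<close> matter.
\<close>

definition markov_semigroup :: "'a measure \<Rightarrow> (real \<Rightarrow> 'a \<Rightarrow> 'a measure) \<Rightarrow> bool" where
  "markov_semigroup M S \<longleftrightarrow>
     (\<forall>t\<ge>0. S t \<in> M \<rightarrow>\<^sub>M prob_algebra M) \<and>
     (\<forall>x\<in>space M. S 0 x = return M x) \<and>
     (\<forall>s\<ge>0. \<forall>t\<ge>0. \<forall>x\<in>space M. S (s + t) x = S s x \<bind> S t)"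

definition evolve :: "(real \<Rightarrow> 'a \<Rightarrow> 'a measure) \<Rightarrow> 'a measure \<Rightarrow> real \<Rightarrow> 'a measure" where
  "evolve S \<mu> t = \<mu> \<bind> S t"

text \<open>
  A class of initial distributions is closed under the evolution. A coarse MLSI on the
  class would otherwise say nothing about the distributions at positive times.
\<close>

definition admissible_class ::
    "'a measure \<Rightarrow> (real \<Rightarrow> 'a \<Rightarrow> 'a measure) \<Rightarrow> 'a measure set \<Rightarrow> bool" where
  "admissible_class M S A \<longleftrightarrow>
     A \<subseteq> space (prob_algebra M) \<and> (\<forall>\<mu>\<in>A. \<forall>t\<ge>0. evolve S \<mu> t \<in> A)"

definition lyapunov_functional ::
    "(real \<Rightarrow> 'a \<Rightarrow> 'a measure) \<Rightarrow> 'a measure set \<Rightarrow> ('a measure \<Rightarrow> real) \<Rightarrow> bool" where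
  "lyapunov_functional S A F \<longleftrightarrow> (\<forall>\<mu>\<in>A. \<forall>t\<ge>0. F (evolve S \<mu> t) \<le> F \<mu>)"

text \<open>
  The infimum is the minimum when it is attained, and it is used only in that case.
\<close>

definition min_free_energy :: "'a measure \<Rightarrow> ('a measure \<Rightarrow> real) \<Rightarrow> real" where
  "min_free_energy M F = (INF \<nu>\<in>space (prob_algebra M). F \<nu>)"

text \<open>
  The entropy production may be infinite, as it is for Glauber dynamics at a Dirac measure.
  Since \<open>F\<close> is real-valued, the identity forces the time integral to be finite.
\<close>

definition de_bruijn_identity ::
    "(real \<Rightarrow> 'a \<Rightarrow> 'a measure) \<Rightarrow> 'a measure set \<Rightarrow> ('a measure \<Rightarrow> real)
      \<Rightarrow> ('a measure \<Rightarrow> ennreal) \<Rightarrow> bool" where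
  "de_bruijn_identity S A F \<sigma> \<longleftrightarrow>
     (\<forall>\<mu>\<in>A. \<forall>t\<ge>0.
        (\<lambda>s. \<sigma> (evolve S \<mu> s)) \<in> borel_measurable (lebesgue_on {0..t}) \<and>
        ereal (F (evolve S \<mu> t)) =
          ereal (F (evolve S \<mu> 0)) - enn2ereal (\<integral>\<^sup>+ s. \<sigma> (evolve S \<mu> s) \<partial>lebesgue_on {0..t}))"

definition coarse_MLSI ::
    "'a measure \<Rightarrow> 'a measure set \<Rightarrow> ('a measure \<Rightarrow> real) \<Rightarrow> ('a measure \<Rightarrow> ennreal) \<Rightarrow> bool" where
  "coarse_MLSI M A F \<sigma> \<longleftrightarrow>
     (\<forall>\<epsilon>>0. \<exists>\<delta>>0. \<forall>\<mu>\<in>A.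
        enn2ereal (\<sigma> \<mu>) \<ge> ereal (\<delta> * ((F \<mu> - min_free_energy M F) - \<epsilon>)))"

end

theory Submission imports Defs begin

text \<open>
  Along a trajectory the free energy is bounded below, so the total entropy produced over
  \<open>[0, \<infinity>)\<close> is finite. If the free energy stayed above its minimum by \<open>2\<epsilon>\<close>
  forever, the coarse MLSI at scale \<open>\<epsilon>\<close> would keep the entropy production at or above the
  positive constant \<open>\<delta>\<epsilon>\<close>, and the total would be infinite. Hence the excess falls
  below \<open>2\<epsilon>\<close> at some time, and it stays there because the free energy decreases.

  Once the trajectory \<open>f t = F (evolve S \<mu> t)\<close> is fixed this is a statement about real functions,
  \<open>tendsto_of_coarse_dissipation\<close>. Closure of the class under the evolution is what makes
  the coarse MLSI hold at every point of the trajectory. The monotonicity of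
  \<open>f\<close> is read off from the de Bruijn identity, whose integrand is non-negative.
\<close>

lemma nn_integral_lebesgue_on_mono:
  assumes "B \<subseteq> C" "B \<in> sets lebesgue" "C \<in> sets lebesgue"
  shows "(\<integral>\<^sup>+ s. g s \<partial>lebesgue_on B) \<le> (\<integral>\<^sup>+ s. g s \<partial>lebesgue_on C)"
  using assms
  by (subst (1 2) nn_integral_restrict_space)
    (auto intro!: nn_integral_mono split: split_indicator)

lemma nn_integral_lebesgue_on_Icc_ge:
  assumes "0 \<le> t" "0 \<le> c" and "\<And>s. 0 \<le> s \<Longrightarrow> s \<le> t \<Longrightarrow> ennreal c \<le> g s"
  shows "ennreal (c * t) \<le> (\<integral>\<^sup>+ s. g s \<partial>lebesgue_on {0..t})"
proof -
  have "ennreal (c * t) = (\<integral>\<^sup>+ s. ennreal c \<partial>lebesgue_on {0..t})"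
    using assms(1,2) by (simp add: emeasure_restrict_space space_restrict_space ennreal_mult)
  also have "\<dots> \<le> (\<integral>\<^sup>+ s. g s \<partial>lebesgue_on {0..t})"
    by (rule nn_integral_mono) (use assms(3) in \<open>auto simp: space_restrict_space\<close>)
  finally show ?thesis .
qed

lemma tendsto_of_coarse_dissipation:
  fixes f :: "real \<Rightarrow> real" and g :: "real \<Rightarrow> ennreal"
  assumes lower: "\<And>t. 0 \<le> t \<Longrightarrow> m \<le> f t"
    and dissipation: "\<And>t. 0 \<le> t \<Longrightarrow>
      ereal (f t) = ereal (f 0) - enn2ereal (\<integral>\<^sup>+ s. g s \<partial>lebesgue_on {0..t})"
    and coarse: "\<And>\<epsilon>. 0 < \<epsilon> \<Longrightarrow>
      \<exists>\<delta>>0. \<forall>s\<ge>0. ereal (\<delta> * ((f s - m) - \<epsilon>)) \<le> enn2ereal (g s)"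
  shows "(f \<longlongrightarrow> m) at_top"
proof -
  define I where "I t = (\<integral>\<^sup>+ s. g s \<partial>lebesgue_on {0..t})" for t
  have decomp: "\<exists>r\<ge>0. I t = ennreal r \<and> f t = f 0 - r" if "0 \<le> t" for t
    using dissipation[OF that] unfolding I_def[symmetric]
    by (cases "I t") auto
  have decreasing: "f t \<le> f T" if "0 \<le> T" "T \<le> t" for T t
  proof -
    have "I T \<le> I t"
      unfolding I_def using that by (intro nn_integral_lebesgue_on_mono) auto
    then show ?thesis
      using decomp[of T] decomp[of t] that by auto
  qed
  have excess_small: "\<exists>T\<ge>0. f T < m + 2 * \<epsilon>" if "0 < \<epsilon>" for \<epsilon>
  proof (rule ccontr)
    assume "\<not> ?thesis"
    then have stays: "m + 2 * \<epsilon> \<le> f s" if "0 \<le> s" for s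
      using that by force
    obtain \<delta> where "0 < \<delta>"
      and mlsi: "\<And>s. 0 \<le> s \<Longrightarrow> ereal (\<delta> * ((f s - m) - \<epsilon>)) \<le> enn2ereal (g s)"
      using coarse[OF \<open>0 < \<epsilon>\<close>] by blast
    have production: "ennreal (\<delta> * \<epsilon>) \<le> g s" if "0 \<le> s" for s
    proof -
      have "\<delta> * \<epsilon> \<le> \<delta> * ((f s - m) - \<epsilon>)"
        using stays[OF that] \<open>0 < \<delta>\<close> by (intro mult_left_mono) auto
      then have "ereal (\<delta> * \<epsilon>) \<le> enn2ereal (g s)"
        using mlsi[OF that] by (meson ereal_less_eq(3) order_trans)
      then show ?thesis
        using \<open>0 < \<delta>\<close> \<open>0 < \<epsilon>\<close> by (simp add: less_eq_ennreal.rep_eq enn2ereal_ennreal)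
    qed
    \<comment> \<open>By this time a production rate of at least \<open>\<delta>\<epsilon>\<close> has used up more than
      the free energy available above \<open>m\<close>.\<close>
    define t where "t = (f 0 - m + 1) / (\<delta> * \<epsilon>)"
    have "0 \<le> t"
      using lower[of 0] \<open>0 < \<delta>\<close> \<open>0 < \<epsilon>\<close> by (simp add: t_def)
    then have "ennreal (\<delta> * \<epsilon> * t) \<le> I t"
      unfolding I_def using \<open>0 < \<delta>\<close> \<open>0 < \<epsilon>\<close> production
      by (intro nn_integral_lebesgue_on_Icc_ge) auto
    moreover have "\<delta> * \<epsilon> * t = f 0 - m + 1"
      using \<open>0 < \<delta>\<close> \<open>0 < \<epsilon>\<close> by (simp add: t_def)
    ultimately have "f t \<le> m - 1"
      using decomp[OF \<open>0 \<le> t\<close>] by auto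
    then show False
      using lower[OF \<open>0 \<le> t\<close>] by simp
  qed
  show ?thesis
  proof (rule order_tendstoI)
    fix a assume "a < m"
    then show "\<forall>\<^sub>F t in at_top. a < f t"
      using lower by (intro eventually_at_top_linorderI[of 0]) force
  next
    fix a assume "m < a"
    then obtain T where "0 \<le> T" "f T < a"
      using excess_small[of "(a - m) / 2"] by (auto simp: field_simps)
    then show "\<forall>\<^sub>F t in at_top. f t < a"
      using decreasing by (intro eventually_at_top_linorderI[of T]) force
  qed
qed

theorem theorem1p2:
  fixes M :: "'a measure"
    and S :: "real \<Rightarrow> 'a \<Rightarrow> 'a measure"
    and A :: "'a measure set"
    and F :: "'a measure \<Rightarrow> real"
    and \<sigma> :: "'a measure \<Rightarrow> ennreal"
  assumes "markov_semigroup M S"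
    and "admissible_class M S A"
    and "bdd_below (F ` space (prob_algebra M))"
    and "\<exists>\<nu>. is_arg_min F (\<lambda>\<nu>. \<nu> \<in> space (prob_algebra M)) \<nu>"
    and "lyapunov_functional S A F"
    and "de_bruijn_identity S A F \<sigma>"
    and "coarse_MLSI M A F \<sigma>"
  shows "\<forall>\<mu>\<in>A. ((\<lambda>t. F (evolve S \<mu> t)) \<longlongrightarrow> min_free_energy M F) at_top"
proof
  fix \<mu> assume "\<mu> \<in> A"
  then have in_class: "evolve S \<mu> t \<in> A" if "0 \<le> t" for t
    using assms(2) that by (simp add: admissible_class_def)
  show "((\<lambda>t. F (evolve S \<mu> t)) \<longlongrightarrow> min_free_energy M F) at_top"
  proof (rule tendsto_of_coarse_dissipation)
    fix t :: real assume "0 \<le> t"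
    then have "evolve S \<mu> t \<in> space (prob_algebra M)"
      using in_class assms(2) by (auto simp: admissible_class_def)
    then show "min_free_energy M F \<le> F (evolve S \<mu> t)"
      unfolding min_free_energy_def using assms(3) by (rule cINF_lower[rotated])
  next
    fix t :: real assume "0 \<le> t"
    then show "ereal (F (evolve S \<mu> t)) = ereal (F (evolve S \<mu> 0))
        - enn2ereal (\<integral>\<^sup>+ s. \<sigma> (evolve S \<mu> s) \<partial>lebesgue_on {0..t})"
      using assms(6) \<open>\<mu> \<in> A\<close> unfolding de_bruijn_identity_def by blast
  next
    fix \<epsilon> :: real assume "0 < \<epsilon>"
    then show "\<exists>\<delta>>0. \<forall>s\<ge>0. ereal (\<delta> * ((F (evolve S \<mu> s) - min_free_energy M F) - \<epsilon>))
        \<le> enn2ereal (\<sigma> (evolve S \<mu> s))"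
      using assms(7) in_class unfolding coarse_MLSI_def by meson
  qed
qed

end
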